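(* Let $X,Y$ be normed spaces, let $A$ be a linear operator with domain $D\subset X$ and range $R\subset Y$ such that the problem $Au=f$ ($f\in Y$) is well-posed with bounded linear solution operator $E\in B(Y,X)$, and let $(X_h,Y_h,A_h,r_h,s_h)_{h\in H}$ be a method for this problem, with discrete solution operators $E_h=A_h^{-1}$ (all in the sense given in the context). Suppose that the method is consistent and stable. Then the method is convergent, i.e., for every $f\in Y$, $$\lim_{h\to 0}\|r_hEf-E_hs_hf\|_{X_h}=0 .$$
   Context: **Continuous problem.** $X$ (space of solutions) and $Y$ (space of data) are normed spaces, both real or both complex. $A$ is a linear operator, not assumed bounded, with domain $D\subset X$ and range $R\subset Y$. The problem is: given $f\in Y$, solve $Au=f$. It is assumed well-posed: there is a bounded linear operator $E\in B(Y,X)$ with $EA=I$ on $D$, and for every $f\in Y$ the equation $Au=f$ has a unique solution, namely $u=Ef$. **Approximate problem and method.** $H$ is a set of positive numbers such that $0$ is the unique limit point of $H$; limits as $h\to0$ are taken along $h\in H$. For each $h\in H$, $X_h,Y_h$ are normed spaces and $A_h:X_h\to Y_h$ is a linear operator. The approximate problem is $A_hu_h=f_h$, $f_h\in Y_h$; it is assumed well-posed for each $h\in H$, with bounded linear solution operator $E_h=A_h^{-1}:Y_h\to X_h$. For each $h\in H$, $r_h:X\to X_h$ and $s_h:Y\to Y_h$ are bounded linear operators with $\|r_h\|\le C_1$ and $\|s_h\|\le C_2$, where $C_1,C_2$ are constants independent of $h$. The family $(X_h,Y_h,A_h,r_h,s_h)$ is called a method for the solution of $Au=f$. **Consistency.**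 The method is consistent at $u\in D$ if $\lim_{h\to0}\|A_hr_hu-s_hAu\|_{Y_h}=0$. The method is consistent if it is consistent at each $u$ in a set $D_0\subset D$ whose image $A(D_0)$ is dense in $Y$. **Stability.** The method is stable if there exists a constant $K$ (independent of $h$) such that $\|E_h\|_{B(Y_h,X_h)}\le K$ for all $h\in H$. **Convergence.** The method is convergent for $f\in Y$ if $\lim_{h\to0}\|r_hEf-E_hs_hf\|_{X_h}=0$; it is convergent if this holds for every $f\in Y$. *)

theory Defs
  imports "HOL-Analysis.Analysis" "HOL-Algebra.Algebraic_Closure_Type"
begin

section \<open>Normed spaces with explicit carriers\<close>

text \<open>
  The discrete spaces vary with the parameter \<open>h\<close>, so normed spaces are structures with a carrier
  rather than types of class \<^class>\<open>real_normed_vector\<close>.  The scalars are the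
  elements of a type of class \<^class>\<open>real_normed_field\<close>.  The types \<^typ>\<open>real\<close> and
  \<^typ>\<open>complex\<close> are instances, and by the Gelfand--Mazur theorem every instance
  is isometrically isomorphic to one of the two.

  The record \<open>module\<close> extends \<open>ring\<close>; its fields \<open>mult\<close> and \<open>one\<close> play no role for a module.
\<close>

record ('k, 'v) normed_module = "('k, 'v) module" +
  vnorm :: "'v \<Rightarrow> real"

abbreviation scalars :: "'k :: real_normed_field ring"
  where "scalars \<equiv> ring_of_type_algebra"

locale normed_space = Module.module scalars V
  for V :: "('k :: real_normed_field, 'v) normed_module" (structure) +
  assumes vnorm_eq_zero_iff: "x \<in> carrier V \<Longrightarrow> vnorm V x = 0 \<longleftrightarrow> x = \<zero>"
    and vnorm_triangle:
      "\<lbrakk>x \<in> carrier V; y \<in> carrier V\<rbrakk> \<Longrightarrow> vnorm V (x \<oplus> y) \<le> vnorm V x + vnorm V y"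
    and vnorm_smult: "x \<in> carrier V \<Longrightarrow> vnorm V (c \<odot> x) = norm c * vnorm V x"

text \<open>
  The locale \<^locale>\<open>Metric_space\<close> asks for nonnegativity and symmetry on the whole type, hence the
  value \<open>0\<close> outside the carrier.
\<close>

definition ndist :: "('k :: real_normed_field, 'v) normed_module \<Rightarrow> 'v \<Rightarrow> 'v \<Rightarrow> real"
  where "ndist V x y =
    (if x \<in> carrier V \<and> y \<in> carrier V then vnorm V (x \<ominus>\<^bsub>V\<^esub> y) else 0)"

definition ntopology :: "('k :: real_normed_field, 'v) normed_module \<Rightarrow> 'v topology"
  where "ntopology V = Metric_space.mtopology (carrier V) (ndist V)"

definition dense_in :: "('k :: real_normed_field, 'v) normed_module \<Rightarrow> 'v set \<Rightarrow> bool"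
  where "dense_in V S \<longleftrightarrow> S \<subseteq> carrier V \<and> ntopology V closure_of S = carrier V"

context normed_space
begin

lemma vnorm_zero: "vnorm V \<zero> = 0"
  by (simp add: vnorm_eq_zero_iff)

lemma vnorm_uminus:
  assumes "x \<in> carrier V"
  shows "vnorm V (\<ominus> x) = vnorm V x"
proof -
  have one: "1 \<odot> x = x"
    using smult_one[OF assms] by (simp add: ring_of_type_algebra_def)
  have "(- 1) \<odot> x \<oplus> 1 \<odot> x = (- 1 + 1) \<odot> x"
    using smult_l_distr[of "- 1" 1 x] assms by (simp add: ring_of_type_algebra_def)
  moreover have "vnorm V (0 \<odot> x) = 0"
    using vnorm_smult[OF assms, of 0] by simp
  moreover have closed: "c \<odot> x \<in> carrier V" for c
    using smult_closed[of c x] assms by (simp add: ring_of_type_algebra_def)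
  ultimately have "(- 1) \<odot> x \<oplus> x = \<zero>"
    using one vnorm_eq_zero_iff[of "0 \<odot> x"] by simp
  then have "\<ominus> x = (- 1) \<odot> x"
    using assms closed M.minus_equality by blast
  then show ?thesis
    using vnorm_smult[OF assms, of "- 1"] by simp
qed

lemma vnorm_nonneg:
  assumes "x \<in> carrier V"
  shows "0 \<le> vnorm V x"
  using vnorm_triangle[of x "\<ominus> x"] assms by (simp add: vnorm_uminus vnorm_zero M.r_neg)

lemma Metric_space_ndist: "Metric_space (carrier V) (ndist V)"
proof
  fix x y z
  show "0 \<le> ndist V x y"
    by (simp add: ndist_def vnorm_nonneg)
  show "ndist V x y = ndist V y x"
    using vnorm_uminus[of "x \<ominus> y"]
    by (auto simp: ndist_def M.minus_add a_minus_def M.minus_minus M.a_comm)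
  assume xy: "x \<in> carrier V" "y \<in> carrier V"
  then have "x \<ominus> y = \<zero> \<longleftrightarrow> x = y"
    by (metis M.a_inv_closed M.minus_equality M.minus_minus M.r_neg a_minus_def)
  then show "ndist V x y = 0 \<longleftrightarrow> x = y"
    using xy by (simp add: ndist_def vnorm_eq_zero_iff)
  assume z: "z \<in> carrier V"
  have "(x \<ominus> y) \<oplus> (y \<ominus> z) = x \<ominus> z"
    using xy z by (simp add: a_minus_def M.a_assoc M.r_neg2 M.r_neg1)
  then show "ndist V x z \<le> ndist V x y + ndist V y z"
    using vnorm_triangle[of "x \<ominus> y" "y \<ominus> z"] xy z by (simp add: ndist_def)
qed

end


section \<open>Linear operators\<close>

locale linear_operator = V: normed_space V + W: normed_space W
  for V :: "('k :: real_normed_field, 'v) normed_module"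
    and W :: "('k, 'w) normed_module" +
  fixes D :: "'v set"
    and T :: "'v \<Rightarrow> 'w"
  assumes domain_submodule: "submodule D scalars V"
    and op_closed: "x \<in> D \<Longrightarrow> T x \<in> carrier W"
    and op_add: "\<lbrakk>x \<in> D; y \<in> D\<rbrakk> \<Longrightarrow> T (x \<oplus>\<^bsub>V\<^esub> y) = T x \<oplus>\<^bsub>W\<^esub> T y"
    and op_smult: "x \<in> D \<Longrightarrow> T (c \<odot>\<^bsub>V\<^esub> x) = c \<odot>\<^bsub>W\<^esub> T x"

locale bounded_operator = linear_operator V W "carrier V" T
  for V :: "('k :: real_normed_field, 'v) normed_module"
    and W :: "('k, 'w) normed_module"
    and T :: "'v \<Rightarrow> 'w" +
  assumes op_bounded: "\<exists>C. \<forall>x \<in> carrier V. vnorm W (T x) \<le> C * vnorm V x"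

text \<open>
  The carrier version of \<^const>\<open>onorm\<close>; by the convention \<open>0 / 0 = 0\<close>
  the zero vector contributes the value \<open>0\<close>.  It is only meaningful for a bounded operator.
\<close>

definition op_norm ::
    "('k :: real_normed_field, 'v) normed_module \<Rightarrow> ('k, 'w) normed_module \<Rightarrow> ('v \<Rightarrow> 'w) \<Rightarrow> real"
  where "op_norm V W T = (SUP x \<in> carrier V. vnorm W (T x) / vnorm V x)"


section \<open>Well-posed problems\<close>

text \<open>
  The problem \<open>A u = f\<close> with \<open>u \<in> D\<close>, and its solution operator \<open>E\<close>.
  The spaces are written \<open>\<X>\<close> and \<open>\<Y>\<close> because the plain letter \<open>X\<close> is taken by the notation
  for the indeterminate in HOL-Algebra.
\<close>

locale wellposed_problem = linear_operator \<X> \<Y> D A + solution: bounded_operator \<Y> \<X> E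
  for \<X> :: "('k :: real_normed_field, 'x) normed_module"
    and \<Y> :: "('k, 'y) normed_module"
    and D :: "'x set"
    and A :: "'x \<Rightarrow> 'y"
    and E :: "'y \<Rightarrow> 'x" +
  assumes solution_left_inverse: "u \<in> D \<Longrightarrow> E (A u) = u"
    and unique_solution: "f \<in> carrier \<Y> \<Longrightarrow> \<exists>!u. u \<in> D \<and> A u = f"
    and solution_in_domain: "f \<in> carrier \<Y> \<Longrightarrow> E f \<in> D"
    and solution_solves: "f \<in> carrier \<Y> \<Longrightarrow> A (E f) = f"


section \<open>Discretization methods\<close>

text \<open>
  The spaces \<open>Xh h\<close> share one element type, but each has its own carrier, operations and norm;
  likewise \<open>Yh h\<close>.  Nothing is assumed for \<open>h \<notin> H\<close>.
\<close>

locale discretization_method = wellposed_problem \<X> \<Y> D A E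
  for \<X> :: "('k :: real_normed_field, 'x) normed_module"
    and \<Y> :: "('k, 'y) normed_module"
    and D :: "'x set"
    and A :: "'x \<Rightarrow> 'y"
    and E :: "'y \<Rightarrow> 'x" +
  fixes H :: "real set"
    and Xh :: "real \<Rightarrow> ('k, 'a) normed_module"
    and Yh :: "real \<Rightarrow> ('k, 'b) normed_module"
    and Ah :: "real \<Rightarrow> 'a \<Rightarrow> 'b"
    and Eh :: "real \<Rightarrow> 'b \<Rightarrow> 'a"
    and r :: "real \<Rightarrow> 'x \<Rightarrow> 'a"
    and s :: "real \<Rightarrow> 'y \<Rightarrow> 'b"
  assumes H_pos: "h \<in> H \<Longrightarrow> h > 0"
    and H_limit_point: "x islimpt H \<longleftrightarrow> x = 0"
    and discrete_wellposed:
      "h \<in> H \<Longrightarrow> wellposed_problem (Xh h) (Yh h) (carrier (Xh h)) (Ah h) (Eh h)"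
    and r_bounded: "h \<in> H \<Longrightarrow> bounded_operator \<X> (Xh h) (r h)"
    and s_bounded: "h \<in> H \<Longrightarrow> bounded_operator \<Y> (Yh h) (s h)"
    and r_uniform: "\<exists>C1. \<forall>h\<in>H. op_norm \<X> (Xh h) (r h) \<le> C1"
    and s_uniform: "\<exists>C2. \<forall>h\<in>H. op_norm \<Y> (Yh h) (s h) \<le> C2"

definition consistent_at ::
    "('x \<Rightarrow> 'y) \<Rightarrow> real set \<Rightarrow> (real \<Rightarrow> ('k :: real_normed_field, 'b) normed_module) \<Rightarrow>
     (real \<Rightarrow> 'a \<Rightarrow> 'b) \<Rightarrow> (real \<Rightarrow> 'x \<Rightarrow> 'a) \<Rightarrow> (real \<Rightarrow> 'y \<Rightarrow> 'b) \<Rightarrow> 'x \<Rightarrow> bool"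
  where "consistent_at A H Yh Ah r s u \<longleftrightarrow>
    ((\<lambda>h. vnorm (Yh h) (Ah h (r h u) \<ominus>\<^bsub>Yh h\<^esub> s h (A u))) \<longlongrightarrow> 0) (at 0 within H)"

definition consistent_method ::
    "('k :: real_normed_field, 'y) normed_module \<Rightarrow> 'x set \<Rightarrow> ('x \<Rightarrow> 'y) \<Rightarrow> real set \<Rightarrow>
     (real \<Rightarrow> ('k, 'b) normed_module) \<Rightarrow> (real \<Rightarrow> 'a \<Rightarrow> 'b) \<Rightarrow>
     (real \<Rightarrow> 'x \<Rightarrow> 'a) \<Rightarrow> (real \<Rightarrow> 'y \<Rightarrow> 'b) \<Rightarrow> bool"
  where "consistent_method \<Y> D A H Yh Ah r s \<longleftrightarrow>
    (\<exists>D0 \<subseteq> D. dense_in \<Y> (A ` D0) \<and> (\<forall>u \<in> D0. consistent_at A H Yh Ah r s u))"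

definition stable_method ::
    "real set \<Rightarrow> (real \<Rightarrow> ('k :: real_normed_field, 'a) normed_module) \<Rightarrow>
     (real \<Rightarrow> ('k, 'b) normed_module) \<Rightarrow> (real \<Rightarrow> 'b \<Rightarrow> 'a) \<Rightarrow> bool"
  where "stable_method H Xh Yh Eh \<longleftrightarrow> (\<exists>K. \<forall>h \<in> H. op_norm (Yh h) (Xh h) (Eh h) \<le> K)"

definition convergent_for ::
    "('y \<Rightarrow> 'x) \<Rightarrow> real set \<Rightarrow> (real \<Rightarrow> ('k :: real_normed_field, 'a) normed_module) \<Rightarrow>
     (real \<Rightarrow> 'b \<Rightarrow> 'a) \<Rightarrow> (real \<Rightarrow> 'x \<Rightarrow> 'a) \<Rightarrow> (real \<Rightarrow> 'y \<Rightarrow> 'b) \<Rightarrow> 'y \<Rightarrow> bool"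
  where "convergent_for E H Xh Eh r s f \<longleftrightarrow>
    ((\<lambda>h. vnorm (Xh h) (r h (E f) \<ominus>\<^bsub>Xh h\<^esub> Eh h (s h f))) \<longlongrightarrow> 0) (at 0 within H)"

definition convergent_method ::
    "('k :: real_normed_field, 'y) normed_module \<Rightarrow> ('y \<Rightarrow> 'x) \<Rightarrow> real set \<Rightarrow>
     (real \<Rightarrow> ('k, 'a) normed_module) \<Rightarrow> (real \<Rightarrow> 'b \<Rightarrow> 'a) \<Rightarrow>
     (real \<Rightarrow> 'x \<Rightarrow> 'a) \<Rightarrow> (real \<Rightarrow> 'y \<Rightarrow> 'b) \<Rightarrow> bool"
  where "convergent_method \<Y> E H Xh Eh r s \<longleftrightarrow>
    (\<forall>f \<in> carrier \<Y>. convergent_for E H Xh Eh r s f)"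

end

theory Submission
  imports Defs
begin

text \<open>
  The error operators \<open>T\<^sub>h f = r\<^sub>h E f - E\<^sub>h s\<^sub>h f\<close> are linear in \<open>f\<close>, and convergence of
  the method says that they tend to zero pointwise on \<open>\<Y>\<close>.  Two facts give this.

  Boundedness of \<open>E\<close>, the uniform bounds on \<open>r\<^sub>h\<close> and \<open>s\<^sub>h\<close>, and stability bound the operators
  \<open>T\<^sub>h\<close> by one constant \<open>L = C\<^sub>1 \<parallel>E\<parallel> + K C\<^sub>2\<close>.  An equibounded family of linear operators that tends
  to zero pointwise on a dense set does so everywhere
  (\<open>equibounded_tendsto_zero_from_dense\<close>): moving \<open>f\<close> by \<open>\<delta>\<close> moves \<open>T\<^sub>h f\<close> by at most \<open>L \<delta>\<close>,
  for all \<open>h\<close> at once.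

  The dense set is the image under \<open>A\<close> of the elements at which the method is consistent.  If
  \<open>f = A u\<close>, then \<open>E f = u\<close> and \<open>E\<^sub>h A\<^sub>h = I\<close> give \<open>T\<^sub>h f = E\<^sub>h (A\<^sub>h r\<^sub>h u - s\<^sub>h A u)\<close>, so that the error is the
  discrete solution operator applied to the consistency error, and stability
  makes it vanish in the limit (\<open>consistent_at_imp_convergent_for\<close>).
\<close>

section \<open>Linear operators between normed spaces with carriers\<close>

context normed_space
begin

lemma smult_in_carrier: "x \<in> carrier V \<Longrightarrow> c \<odot> x \<in> carrier V"
  using smult_closed[of c x] by (simp add: ring_of_type_algebra_def)

lemma smult_diff:
  assumes "x \<in> carrier V" "y \<in> carrier V"
  shows "c \<odot> (x \<ominus> y) = c \<odot> x \<ominus> c \<odot> y"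
  using assms smult_r_distr[of c x "\<ominus> y"] smult_r_minus[of c y]
  by (simp add: a_minus_def ring_of_type_algebra_def)

lemma vnorm_diff_le:
  assumes "x \<in> carrier V" "y \<in> carrier V"
  shows "vnorm V (x \<ominus> y) \<le> vnorm V x + vnorm V y"
  using vnorm_triangle[of x "\<ominus> y"] assms by (simp add: a_minus_def vnorm_uminus)

lemma dense_in_approximation:
  assumes "dense_in V S" "f \<in> carrier V" "\<epsilon> > 0"
  obtains g where "g \<in> S" "g \<in> carrier V" "vnorm V (f \<ominus> g) < \<epsilon>"
proof -
  interpret M: Metric_space "carrier V" "ndist V"
    by (rule Metric_space_ndist)
  have "f \<in> M.mtopology closure_of S"
    using assms by (simp add: dense_in_def ntopology_def)
  then obtain g where "g \<in> S" "g \<in> M.mball f \<epsilon>"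
    using assms(3) by (auto simp: M.metric_closure_of)
  then show ?thesis
    using that by (auto simp: ndist_def)
qed

end

lemma linear_operator_compose:
  assumes "linear_operator V W (carrier V) S" "linear_operator W Z (carrier W) T"
  shows "linear_operator V Z (carrier V) (\<lambda>x. T (S x))"
proof -
  interpret S: linear_operator V W "carrier V" S by fact
  interpret T: linear_operator W Z "carrier W" T by fact
  show ?thesis
    by unfold_locales
      (auto simp: S.V.carrier_is_submodule S.op_closed S.op_add S.op_smult
        T.op_closed T.op_add T.op_smult)
qed

lemma linear_operator_minus:
  assumes "linear_operator V W (carrier V) S" "linear_operator V W (carrier V) T"
  shows "linear_operator V W (carrier V) (\<lambda>x. S x \<ominus>\<^bsub>W\<^esub> T x)"
proof -
  interpret S: linear_operator V W "carrier V" S by fact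
  interpret T: linear_operator V W "carrier V" T by fact
  have "S (x \<oplus>\<^bsub>V\<^esub> y) \<ominus>\<^bsub>W\<^esub> T (x \<oplus>\<^bsub>V\<^esub> y) = (S x \<ominus>\<^bsub>W\<^esub> T x) \<oplus>\<^bsub>W\<^esub> (S y \<ominus>\<^bsub>W\<^esub> T y)"
    if "x \<in> carrier V" "y \<in> carrier V" for x y
    using that S.op_closed T.op_closed
    by (simp add: S.op_add T.op_add a_minus_def S.W.M.minus_add S.W.M.a_ac)
  then show ?thesis
    by unfold_locales
      (auto simp: S.V.carrier_is_submodule S.op_closed T.op_closed S.op_smult T.op_smult
        S.W.smult_diff)
qed

lemma linear_operator_diff:
  assumes "linear_operator V W (carrier V) T" "x \<in> carrier V" "y \<in> carrier V"
  shows "T (x \<ominus>\<^bsub>V\<^esub> y) = T x \<ominus>\<^bsub>W\<^esub> T y"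
proof -
  interpret linear_operator V W "carrier V" T by fact
  have "T (x \<ominus>\<^bsub>V\<^esub> y) \<oplus>\<^bsub>W\<^esub> T y = T x"
    using assms(2,3) op_add[of "x \<ominus>\<^bsub>V\<^esub> y" y]
    by (simp add: a_minus_def V.M.a_assoc V.M.l_neg)
  then have "T x \<ominus>\<^bsub>W\<^esub> T y = (T (x \<ominus>\<^bsub>V\<^esub> y) \<oplus>\<^bsub>W\<^esub> T y) \<ominus>\<^bsub>W\<^esub> T y"
    by simp
  also have "\<dots> = T (x \<ominus>\<^bsub>V\<^esub> y)"
    using assms(2,3) by (simp add: op_closed a_minus_def W.M.a_assoc W.M.r_neg)
  finally show ?thesis by simp
qed

lemma (in linear_operator) domain_subset_carrier: "D \<subseteq> carrier V"
  by (rule V.submoduleE(1)[OF domain_submodule])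

text \<open>
  The quotients in \<^const>\<open>op_norm\<close> have an upper bound because the operator is bounded.  At
  a vector of norm \<open>0\<close> the quotient carries no information, but there the bound on
  the operator already forces the image to have norm \<open>0\<close>.
\<close>

lemma (in bounded_operator) vnorm_le_op_norm:
  assumes x: "x \<in> carrier V"
  shows "vnorm W (T x) \<le> op_norm V W T * vnorm V x"
proof -
  obtain C where C: "\<And>y. y \<in> carrier V \<Longrightarrow> vnorm W (T y) \<le> C * vnorm V y"
    using op_bounded by blast
  show ?thesis
  proof (cases "vnorm V x = 0")
    case True
    then show ?thesis using C[OF x] by simp
  next
    case False
    have "vnorm W (T y) / vnorm V y \<le> max C 0" if y: "y \<in> carrier V" for y
    proof (cases "vnorm V y = 0")
      case False
      then have "vnorm V y > 0" using V.vnorm_nonneg[OF y] by simp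
      then have "vnorm W (T y) / vnorm V y \<le> C"
        using C[OF y] by (simp add: field_simps)
      then show ?thesis by simp
    qed simp
    then have "bdd_above ((\<lambda>y. vnorm W (T y) / vnorm V y) ` carrier V)"
      by (intro bdd_aboveI2)
    then have "vnorm W (T x) / vnorm V x \<le> op_norm V W T"
      unfolding op_norm_def using x by (rule cSUP_upper[rotated])
    then show ?thesis
      using False V.vnorm_nonneg[OF x] by (simp add: field_simps)
  qed
qed

lemma (in bounded_operator) vnorm_le_of_op_norm_le:
  assumes "op_norm V W T \<le> c" "x \<in> carrier V"
  shows "vnorm W (T x) \<le> c * vnorm V x"
  using vnorm_le_op_norm[OF assms(2)] mult_right_mono[OF assms(1) V.vnorm_nonneg[OF assms(2)]]
  by (rule order_trans)

text \<open>
  The elementary half of the Banach--Steinhaus principle: given \<open>f\<close>, choose \<open>g\<close> in the dense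
  set so close to \<open>f\<close> that \<open>L \<parallel>f - g\<parallel>\<close> takes up at most half of the tolerance, and leave the
  other half to \<open>T\<^sub>h g\<close>.  Linearity and the bound are asked for eventually along \<open>F\<close>, because
  the operators of a method are operators only for \<open>h \<in> H\<close>.
\<close>

lemma equibounded_tendsto_zero_from_dense:
  assumes V: "normed_space V"
    and lin: "\<forall>\<^sub>F h in F. linear_operator V (W h) (carrier V) (T h)"
    and bound: "\<forall>\<^sub>F h in F. \<forall>f \<in> carrier V. vnorm (W h) (T h f) \<le> L * vnorm V f"
    and dense: "dense_in V S"
    and lim: "\<And>g. g \<in> S \<Longrightarrow> ((\<lambda>h. vnorm (W h) (T h g)) \<longlongrightarrow> 0) F"
    and f: "f \<in> carrier V"
  shows "((\<lambda>h. vnorm (W h) (T h f)) \<longlongrightarrow> 0) F"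
proof (rule tendstoI)
  fix \<epsilon> :: real assume "\<epsilon> > 0"
  interpret V: normed_space V by fact
  \<comment> \<open>The summand \<open>1\<close> keeps the denominator positive when \<open>L = 0\<close>.\<close>
  define \<delta> where "\<delta> = \<epsilon> / (2 * (\<bar>L\<bar> + 1))"
  have "\<delta> > 0" using \<open>\<epsilon> > 0\<close> by (simp add: \<delta>_def)
  then obtain g where g: "g \<in> S" "g \<in> carrier V" "vnorm V (f \<ominus>\<^bsub>V\<^esub> g) < \<delta>"
    using V.dense_in_approximation[OF dense f] by blast
  have "L * vnorm V (f \<ominus>\<^bsub>V\<^esub> g) \<le> (\<bar>L\<bar> + 1) * \<delta>"
    using g f V.vnorm_nonneg[of "f \<ominus>\<^bsub>V\<^esub> g"] by (intro mult_mono) auto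
  also have "\<dots> = \<epsilon> / 2"
    by (simp add: \<delta>_def field_simps)
  finally have small: "L * vnorm V (f \<ominus>\<^bsub>V\<^esub> g) \<le> \<epsilon> / 2" .
  have "\<forall>\<^sub>F h in F. dist (vnorm (W h) (T h g)) 0 < \<epsilon> / 2"
    using lim[OF g(1)] \<open>\<epsilon> > 0\<close> by (intro tendstoD) auto
  then show "\<forall>\<^sub>F h in F. dist (vnorm (W h) (T h f)) 0 < \<epsilon>"
    using lin bound
  proof eventually_elim
    case (elim h)
    interpret T: linear_operator V "W h" "carrier V" "T h" by (rule elim(2))
    have "T h f = T h ((f \<ominus>\<^bsub>V\<^esub> g) \<oplus>\<^bsub>V\<^esub> g)"
      using f g(2) by (simp add: a_minus_def V.M.a_assoc V.M.l_neg)
    then have "vnorm (W h) (T h f) \<le> vnorm (W h) (T h (f \<ominus>\<^bsub>V\<^esub> g)) + vnorm (W h) (T h g)"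
      using f g(2) T.W.vnorm_triangle[of "T h (f \<ominus>\<^bsub>V\<^esub> g)" "T h g"]
      by (simp add: T.op_add T.op_closed)
    moreover have "vnorm (W h) (T h (f \<ominus>\<^bsub>V\<^esub> g)) \<le> L * vnorm V (f \<ominus>\<^bsub>V\<^esub> g)"
      using elim(3) f g(2) by simp
    moreover have "vnorm (W h) (T h g) < \<epsilon> / 2"
      using elim(1) by simp
    ultimately have "vnorm (W h) (T h f) < \<epsilon>"
      using small by linarith
    then show ?case
      using T.W.vnorm_nonneg[OF T.op_closed[OF f]] by simp
  qed
qed

section \<open>The error operators of a method\<close>

context discretization_method
begin

lemma eventually_in_H: "(\<And>h. h \<in> H \<Longrightarrow> P h) \<Longrightarrow> \<forall>\<^sub>F h in at 0 within H. P h"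
  by (simp add: eventually_at_filter)

lemma linear_operator_error:
  assumes h: "h \<in> H"
  shows "linear_operator \<Y> (Xh h) (carrier \<Y>) (\<lambda>f. r h (E f) \<ominus>\<^bsub>Xh h\<^esub> Eh h (s h f))"
proof -
  interpret disc: wellposed_problem "Xh h" "Yh h" "carrier (Xh h)" "Ah h" "Eh h"
    by (rule discrete_wellposed[OF h])
  interpret r: bounded_operator \<X> "Xh h" "r h" by (rule r_bounded[OF h])
  interpret s: bounded_operator \<Y> "Yh h" "s h" by (rule s_bounded[OF h])
  show ?thesis
    by (intro linear_operator_minus
        linear_operator_compose[OF solution.linear_operator_axioms r.linear_operator_axioms]
        linear_operator_compose[OF s.linear_operator_axioms disc.solution.linear_operator_axioms])
qed

lemma error_equibounded:
  assumes stable: "stable_method H Xh Yh Eh"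
  obtains L where "\<And>h f. \<lbrakk>h \<in> H; f \<in> carrier \<Y>\<rbrakk> \<Longrightarrow>
    vnorm (Xh h) (r h (E f) \<ominus>\<^bsub>Xh h\<^esub> Eh h (s h f)) \<le> L * vnorm \<Y> f"
proof -
  obtain C1 where C1: "\<And>h. h \<in> H \<Longrightarrow> op_norm \<X> (Xh h) (r h) \<le> C1"
    using r_uniform by blast
  obtain C2 where C2: "\<And>h. h \<in> H \<Longrightarrow> op_norm \<Y> (Yh h) (s h) \<le> C2"
    using s_uniform by blast
  obtain K where K: "\<And>h. h \<in> H \<Longrightarrow> op_norm (Yh h) (Xh h) (Eh h) \<le> K"
    using stable by (auto simp: stable_method_def)
  \<comment> \<open>Absolute values make the outer constants nonnegative, as composing the estimates requires.\<close>
  have "vnorm (Xh h) (r h (E f) \<ominus>\<^bsub>Xh h\<^esub> Eh h (s h f))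
      \<le> (\<bar>C1\<bar> * op_norm \<Y> \<X> E + \<bar>K\<bar> * C2) * vnorm \<Y> f"
    if h: "h \<in> H" and f: "f \<in> carrier \<Y>" for h f
  proof -
    interpret disc: wellposed_problem "Xh h" "Yh h" "carrier (Xh h)" "Ah h" "Eh h"
      by (rule discrete_wellposed[OF h])
    interpret r: bounded_operator \<X> "Xh h" "r h" by (rule r_bounded[OF h])
    interpret s: bounded_operator \<Y> "Yh h" "s h" by (rule s_bounded[OF h])
    have Ef: "E f \<in> carrier \<X>" and sf: "s h f \<in> carrier (Yh h)"
      using f by (simp_all add: solution.op_closed s.op_closed)
    have "op_norm \<X> (Xh h) (r h) \<le> \<bar>C1\<bar>" "op_norm (Yh h) (Xh h) (Eh h) \<le> \<bar>K\<bar>"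
      using C1[OF h] K[OF h] by simp_all
    then have "vnorm (Xh h) (r h (E f)) \<le> \<bar>C1\<bar> * vnorm \<X> (E f)"
      and "vnorm (Xh h) (Eh h (s h f)) \<le> \<bar>K\<bar> * vnorm (Yh h) (s h f)"
      using r.vnorm_le_of_op_norm_le[OF _ Ef] disc.solution.vnorm_le_of_op_norm_le[OF _ sf]
      by blast+
    moreover have "\<bar>C1\<bar> * vnorm \<X> (E f) \<le> \<bar>C1\<bar> * (op_norm \<Y> \<X> E * vnorm \<Y> f)"
      using solution.vnorm_le_op_norm[OF f] by (intro mult_left_mono) auto
    moreover have "\<bar>K\<bar> * vnorm (Yh h) (s h f) \<le> \<bar>K\<bar> * (C2 * vnorm \<Y> f)"
      using s.vnorm_le_of_op_norm_le[OF C2[OF h] f] by (intro mult_left_mono) auto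
    ultimately show ?thesis
      using disc.V.vnorm_diff_le[OF r.op_closed[OF Ef] disc.solution.op_closed[OF sf]]
      by (simp add: algebra_simps)
  qed
  then show ?thesis by (rule that)
qed

lemma error_eq_Eh_consistency_error:
  assumes h: "h \<in> H" and u: "u \<in> D"
  shows "r h (E (A u)) \<ominus>\<^bsub>Xh h\<^esub> Eh h (s h (A u)) = Eh h (Ah h (r h u) \<ominus>\<^bsub>Yh h\<^esub> s h (A u))"
proof -
  interpret disc: wellposed_problem "Xh h" "Yh h" "carrier (Xh h)" "Ah h" "Eh h"
    by (rule discrete_wellposed[OF h])
  interpret r: bounded_operator \<X> "Xh h" "r h" by (rule r_bounded[OF h])
  interpret s: bounded_operator \<Y> "Yh h" "s h" by (rule s_bounded[OF h])
  have "u \<in> carrier \<X>"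
    using u domain_subset_carrier by blast
  then have ru: "r h u \<in> carrier (Xh h)"
    by (rule r.op_closed)
  have "Ah h (r h u) \<in> carrier (Yh h)" "s h (A u) \<in> carrier (Yh h)"
    using ru u by (simp_all add: disc.op_closed s.op_closed op_closed)
  then show ?thesis
    using linear_operator_diff[OF disc.solution.linear_operator_axioms]
    by (simp add: disc.solution_left_inverse[OF ru] solution_left_inverse[OF u])
qed

lemma consistent_at_imp_convergent_for:
  assumes u: "u \<in> D"
    and cons: "consistent_at A H Yh Ah r s u"
    and stable: "stable_method H Xh Yh Eh"
  shows "convergent_for E H Xh Eh r s (A u)"
proof -
  obtain K where K: "\<And>h. h \<in> H \<Longrightarrow> op_norm (Yh h) (Xh h) (Eh h) \<le> K"
    using stable by (auto simp: stable_method_def)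
  let ?c = "\<lambda>h. Ah h (r h u) \<ominus>\<^bsub>Yh h\<^esub> s h (A u)"
  let ?e = "\<lambda>h. r h (E (A u)) \<ominus>\<^bsub>Xh h\<^esub> Eh h (s h (A u))"
  have bounds: "0 \<le> vnorm (Xh h) (?e h) \<and> vnorm (Xh h) (?e h) \<le> K * vnorm (Yh h) (?c h)"
    if h: "h \<in> H" for h
  proof -
    interpret disc: wellposed_problem "Xh h" "Yh h" "carrier (Xh h)" "Ah h" "Eh h"
      by (rule discrete_wellposed[OF h])
    interpret r: bounded_operator \<X> "Xh h" "r h" by (rule r_bounded[OF h])
    interpret s: bounded_operator \<Y> "Yh h" "s h" by (rule s_bounded[OF h])
    have "u \<in> carrier \<X>"
      using u domain_subset_carrier by blast
    then have c: "?c h \<in> carrier (Yh h)"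
      using u by (simp add: r.op_closed disc.op_closed s.op_closed op_closed)
    show ?thesis
      unfolding error_eq_Eh_consistency_error[OF h u]
      using disc.solution.vnorm_le_of_op_norm_le[OF K[OF h] c]
        disc.V.vnorm_nonneg[OF disc.solution.op_closed[OF c]] by blast
  qed
  have K_cons: "((\<lambda>h. K * vnorm (Yh h) (?c h)) \<longlongrightarrow> 0) (at 0 within H)"
    using tendsto_mult_right_zero cons by (auto simp: consistent_at_def)
  have nonneg: "\<forall>\<^sub>F h in at 0 within H. 0 \<le> vnorm (Xh h) (?e h)"
    and le: "\<forall>\<^sub>F h in at 0 within H. vnorm (Xh h) (?e h) \<le> K * vnorm (Yh h) (?c h)"
    using bounds by (auto intro: eventually_in_H)
  show ?thesis
    unfolding convergent_for_def by (rule tendsto_sandwich[OF nonneg le tendsto_const K_cons])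
qed

end

theorem theorem1:
  fixes \<X> :: "('k :: real_normed_field, 'x) normed_module"
    and \<Y> :: "('k, 'y) normed_module"
    and D :: "'x set"
    and A :: "'x \<Rightarrow> 'y"
    and E :: "'y \<Rightarrow> 'x"
    and H :: "real set"
    and Xh :: "real \<Rightarrow> ('k, 'a) normed_module"
    and Yh :: "real \<Rightarrow> ('k, 'b) normed_module"
    and Ah :: "real \<Rightarrow> 'a \<Rightarrow> 'b"
    and Eh :: "real \<Rightarrow> 'b \<Rightarrow> 'a"
    and r :: "real \<Rightarrow> 'x \<Rightarrow> 'a"
    and s :: "real \<Rightarrow> 'y \<Rightarrow> 'b"
  assumes "discretization_method \<X> \<Y> D A E H Xh Yh Ah Eh r s"
    and "consistent_method \<Y> D A H Yh Ah r s"
    and "stable_method H Xh Yh Eh"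
  shows "convergent_method \<Y> E H Xh Eh r s"
proof -
  interpret discretization_method \<X> \<Y> D A E H Xh Yh Ah Eh r s by fact
  obtain D0 where D0: "D0 \<subseteq> D" "dense_in \<Y> (A ` D0)"
    and cons: "\<And>u. u \<in> D0 \<Longrightarrow> consistent_at A H Yh Ah r s u"
    using assms(2) by (auto simp: consistent_method_def)
  obtain L where L: "\<And>h f. \<lbrakk>h \<in> H; f \<in> carrier \<Y>\<rbrakk> \<Longrightarrow>
      vnorm (Xh h) (r h (E f) \<ominus>\<^bsub>Xh h\<^esub> Eh h (s h f)) \<le> L * vnorm \<Y> f"
    using error_equibounded[OF assms(3)] by blast
  have lim: "((\<lambda>h. vnorm (Xh h) (r h (E g) \<ominus>\<^bsub>Xh h\<^esub> Eh h (s h g))) \<longlongrightarrow> 0) (at 0 within H)"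
    if "g \<in> A ` D0" for g
    using that D0(1) consistent_at_imp_convergent_for[OF _ cons assms(3)]
    by (auto simp: convergent_for_def)
  show ?thesis
    unfolding convergent_method_def convergent_for_def
  proof
    fix f assume f: "f \<in> carrier \<Y>"
    show "((\<lambda>h. vnorm (Xh h) (r h (E f) \<ominus>\<^bsub>Xh h\<^esub> Eh h (s h f))) \<longlongrightarrow> 0) (at 0 within H)"
      by (rule equibounded_tendsto_zero_from_dense[where V = \<Y> and S = "A ` D0" and L = L,
            OF _ _ _ D0(2) lim f])
        (auto intro: eventually_in_H linear_operator_error L W.normed_space_axioms)
  qed
qed

end
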